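(* Let $m,n,p\ge1$ and $\omega=e^{2\pi\sqrt{-1}/p}$. Let $\widehat{\mathcal{A}}\in\mathbb{C}^{m\times n\times p}$ have frontal slices $\widehat{\boldsymbol{A}}^{(1)},\dots,\widehat{\boldsymbol{A}}^{(p)}$, and let $\mathcal{A}$ be the tensor obtained by applying the inverse DFT along the third mode, that is, the tensor with frontal slices $$\boldsymbol{A}^{(k)}=\frac1p\sum_{i=1}^p\omega^{-(i-1)(k-1)}\widehat{\boldsymbol{A}}^{(i)},\qquad k=1,\dots,p.$$ Then $\mathcal{A}$ lies in $\mathbb{R}^{m\times n\times p}$ if and only if $$\widehat{\boldsymbol{A}}^{(1)}=\overline{\widehat{\boldsymbol{A}}^{(1)}}\qquad\text{and}\qquad\widehat{\boldsymbol{A}}^{(p-i+2)}=\overline{\widehat{\boldsymbol{A}}^{(i)}}\quad\text{for every }i=2,\dots,p.$$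
   Context: The frontal slices of a tensor $\mathcal{A}=[a_{ijk}]\in\mathbb{C}^{m\times n\times p}$ are the matrices $\boldsymbol{A}^{(k)}=[a_{ijk}]_{i,j}\in\mathbb{C}^{m\times n}$, $k=1,\dots,p$. The bar denotes entrywise complex conjugation. *)

theory Defs
  imports "HOL-Analysis.Analysis"
begin

text \<open>
  A tensor in \<open>\<complex>\<^sup>m\<^sup>\<times>\<^sup>n\<^sup>\<times>\<^sup>p\<close> is given by its entries. The first two dimensions are
  \<open>CARD('m)\<close> and \<open>CARD('n)\<close>; the third index is a natural number
  ranging over \<open>{1..p}\<close>, because the statement does arithmetic with it. Values at third
  indices outside \<open>{1..p}\<close> carry no meaning, so every notion below that concerns
  the whole tensor takes \<open>p\<close> as a parameter.
\<close>

type_synonym ('m, 'n) tensor = "'m \<Rightarrow> 'n \<Rightarrow> nat \<Rightarrow> complex"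

definition frontal_slice :: "('m::finite, 'n::finite) tensor \<Rightarrow> nat \<Rightarrow> complex^'n^'m" where
  "frontal_slice A k = (\<chi> i j. A i j k)"

definition real_tensor :: "nat \<Rightarrow> ('m::finite, 'n::finite) tensor \<Rightarrow> bool" where
  "real_tensor p A \<longleftrightarrow> (\<forall>i j. \<forall>k\<in>{1..p}. A i j k \<in> \<real>)"

definition smult_matrix :: "complex \<Rightarrow> complex^'n^'m \<Rightarrow> complex^'n^'m" where
  "smult_matrix c M = map_matrix (\<lambda>x. c * x) M"

definition cnj_matrix :: "complex^'n^'m \<Rightarrow> complex^'n^'m" where
  "cnj_matrix M = map_matrix cnj M"

definition dft_root :: "nat \<Rightarrow> complex" where
  "dft_root p = exp (2 * of_real pi * \<i> / of_nat p)"

text \<open>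
  The exponent \<open>-(i-1)(k-1)\<close> is a (nonpositive) integer, hence the integer power and the
  coercions before subtracting.
\<close>

definition is_inverse_dft ::
    "nat \<Rightarrow> ('m::finite, 'n::finite) tensor \<Rightarrow> ('m, 'n) tensor \<Rightarrow> bool" where
  "is_inverse_dft p A' A \<longleftrightarrow>
     (\<forall>k\<in>{1..p}. frontal_slice A k =
        smult_matrix (1 / of_nat p)
          (\<Sum>i = 1..p. smult_matrix (dft_root p powi (- ((int i - 1) * (int k - 1))))
                        (frontal_slice A' i)))"

end

theory Submission imports Defs begin

text \<open>
  Conjugating the transform replaces the coefficients \<open>x i\<close> by \<open>cnj (x (-i))\<close>, indices being
  taken modulo \<open>p\<close> and starting from \<open>0\<close>, because conjugation inverts a root of unity.
  The transform is injective by orthogonality of the powers of a primitive root, so it is real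
  exactly if \<open>x i = cnj (x (-i))\<close> for all \<open>i\<close>.
\<close>

lemma sum_powers_root_of_unity:
  fixes z :: "'a::field"
  assumes "z ^ p = 1"
  shows "(\<Sum>k<p. z ^ k) = (if z = 1 then of_nat p else 0)"
  using assms by (simp add: sum_gp_strict)

text \<open>Summing the vanishing equations over \<open>k\<close> with weights
  \<open>inverse v ^ (j * k)\<close> isolates \<open>of_nat p * d j\<close>, and
  \<open>of_nat p\<close> is nonzero in characteristic 0.\<close>

lemma dft_inj:
  fixes v :: "'a::field_char_0" and d :: "nat \<Rightarrow> 'a"
  assumes root: "v ^ p = 1" and prim: "inj_on (\<lambda>i. v ^ i) {..<p}"
    and zero: "\<And>k. k < p \<Longrightarrow> (\<Sum>i<p. v ^ (i * k) * d i) = 0"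
    and j: "j < p"
  shows "d j = 0"
proof -
  have v0: "v \<noteq> 0"
    using root j by (metis not_less_zero power_0_left zero_neq_one)
  have orth: "(\<Sum>k<p. inverse v ^ (j * k) * v ^ (i * k)) = (if i = j then of_nat p else 0)"
    if i: "i < p" for i
  proof -
    \<comment> \<open>The summands are the powers of this ratio, a root of unity that
      \<open>prim\<close> keeps away from 1 unless \<open>i = j\<close>.\<close>
    define z where "z = v ^ i / v ^ j"
    have "(v ^ n) ^ p = 1" for n
      by (metis mult.commute power_mult power_one root)
    then have "z ^ p = 1"
      by (simp add: z_def power_divide)
    moreover have "z = 1 \<longleftrightarrow> i = j"
      using prim i j v0 by (auto simp: z_def inj_on_def)
    moreover have "inverse v ^ (j * k) * v ^ (i * k) = z ^ k" for k
      by (simp add: z_def power_mult power_divide power_inverse field_simps)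
    ultimately show ?thesis
      by (simp add: sum_powers_root_of_unity)
  qed
  have "0 = (\<Sum>k<p. inverse v ^ (j * k) * (\<Sum>i<p. v ^ (i * k) * d i))"
    by (simp add: zero)
  also have "\<dots> = (\<Sum>i<p. (\<Sum>k<p. inverse v ^ (j * k) * v ^ (i * k)) * d i)"
    unfolding sum_distrib_left sum_distrib_right
    by (subst sum.swap) (simp add: mult.assoc)
  also have "\<dots> = (\<Sum>i<p. if i = j then of_nat p * d i else 0)"
    by (intro sum.cong) (auto simp: orth)
  also have "\<dots> = of_nat p * d j"
    using j by simp
  finally show ?thesis
    using j by simp
qed

text \<open>Conjugation negates the exponent, and reindexing by
  \<open>i \<mapsto> (p - i) mod p\<close> moves that sign to the coefficients. The
  \<open>mod\<close> only matters at \<open>i = 0\<close>, which it keeps fixed.\<close>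

lemma cnj_dft:
  fixes v :: complex and x :: "nat \<Rightarrow> complex"
  assumes root: "v ^ p = 1" and norm: "cnj v = inverse v"
  shows "cnj (\<Sum>i<p. v ^ (i * k) * x i) = (\<Sum>i<p. v ^ (i * k) * cnj (x ((p - i) mod p)))"
proof -
  have refl: "inverse v ^ (i * k) = v ^ ((p - i) mod p * k)" if "i < p" for i
  proof (cases "i = 0")
    case False
    have "v ^ (i * k) * v ^ ((p - i) * k) = (v ^ p) ^ k"
      using that by (simp flip: power_add power_mult add_mult_distrib)
    with False that show ?thesis
      by (simp add: root power_inverse inverse_unique)
  qed simp
  have invol: "(p - (p - i) mod p) mod p = i" if "i < p" for i
    using that by (cases "i = 0") auto
  have "cnj (\<Sum>i<p. v ^ (i * k) * x i) = (\<Sum>i<p. v ^ ((p - i) mod p * k) * cnj (x i))"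
    using norm refl by simp
  also have "\<dots> = (\<Sum>i<p. v ^ (i * k) * cnj (x ((p - i) mod p)))"
    by (rule sum.reindex_bij_witness[of _ "\<lambda>i. (p - i) mod p" "\<lambda>i. (p - i) mod p"])
       (auto simp: invol)
  finally show ?thesis .
qed

lemma dft_real_iff:
  fixes v :: complex and x :: "nat \<Rightarrow> complex"
  assumes root: "v ^ p = 1" and norm: "cnj v = inverse v"
    and prim: "inj_on (\<lambda>i. v ^ i) {..<p}"
  shows "(\<forall>k<p. (\<Sum>i<p. v ^ (i * k) * x i) \<in> \<real>) \<longleftrightarrow> (\<forall>i<p. x ((p - i) mod p) = cnj (x i))"
proof
  assume real: "\<forall>k<p. (\<Sum>i<p. v ^ (i * k) * x i) \<in> \<real>"
  \<comment> \<open>A real value equals its conjugate, so the difference of the two coefficient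
    sequences lies in the kernel of the transform.\<close>
  have "(\<Sum>i<p. v ^ (i * k) * (x i - cnj (x ((p - i) mod p)))) = 0" if "k < p" for k
    using real that cnj_dft[OF root norm, of k x]
    by (simp add: right_diff_distrib sum_subtractf Reals_cnj_iff del: cnj_sum)
  then have "x i - cnj (x ((p - i) mod p)) = 0" if "i < p" for i
    using that by (rule dft_inj[OF root prim, where d = "\<lambda>i. x i - cnj (x ((p - i) mod p))"])
  then show "\<forall>i<p. x ((p - i) mod p) = cnj (x i)"
    by (metis complex_cnj_cnj eq_iff_diff_eq_0)
next
  assume "\<forall>i<p. x ((p - i) mod p) = cnj (x i)"
  then show "\<forall>k<p. (\<Sum>i<p. v ^ (i * k) * x i) \<in> \<real>"
    by (simp add: Reals_cnj_iff cnj_dft[OF root norm] del: cnj_sum)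
qed

text \<open>This is the shape in which \<open>complex_root_unity_eq\<close> compares roots of
  unity.\<close>

lemma dft_root_power: "dft_root p ^ j = exp (2 * of_real pi * \<i> * of_nat j / of_nat p)"
  by (simp add: dft_root_def flip: exp_of_nat_mult)
     (simp add: field_simps)

text \<open>Counting both indices from 0 turns the exponent into \<open>-(i * k)\<close>, hence into
  a natural power of the inverse root.\<close>

lemma inverse_dft_entry:
  assumes "is_inverse_dft p Ahat A" and "k < p"
  shows "A a b (Suc k) =
    of_real (1 / real p) * (\<Sum>i<p. inverse (dft_root p) ^ (i * k) * Ahat a b (Suc i))"
proof -
  have powi: "dft_root p powi (- (int i * int k)) = inverse (dft_root p) ^ (i * k)" for i
    by (simp add: power_int_minus power_inverse flip: of_nat_mult)
  have "frontal_slice A (Suc k) $ a $ b = (smult_matrix (1 / of_nat p)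
          (\<Sum>i = 1..p. smult_matrix (dft_root p powi (- ((int i - 1) * (int (Suc k) - 1))))
                        (frontal_slice Ahat i))) $ a $ b"
    using assms unfolding is_inverse_dft_def by force
  then show ?thesis
    by (simp add: frontal_slice_def smult_matrix_def map_matrix_def sum.atLeast1_atMost_eq powi)
qed

theorem proposition3p17:
  fixes p :: nat and Ahat A :: "('m::finite, 'n::finite) tensor"
  assumes "p \<ge> 1"
    and "is_inverse_dft p Ahat A"
  shows "real_tensor p A \<longleftrightarrow>
    frontal_slice Ahat 1 = cnj_matrix (frontal_slice Ahat 1) \<and>
    (\<forall>i\<in>{2..p}. frontal_slice Ahat (p - i + 2) = cnj_matrix (frontal_slice Ahat i))"
proof -
  define v where "v = inverse (dft_root p)"
  have root: "v ^ p = 1"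
    using assms(1) by (simp add: v_def power_inverse dft_root_power)
  have norm: "cnj v = inverse v"
    by (simp add: v_def dft_root_def exp_cnj flip: exp_minus)
  have prim: "inj_on (\<lambda>i. v ^ i) {..<p}"
  proof (rule inj_onI)
    fix i j
    assume "i \<in> {..<p}" "j \<in> {..<p}" "v ^ i = v ^ j"
    then show "i = j"
      using complex_root_unity_eq[OF assms(1), of i j]
      by (simp add: v_def power_inverse dft_root_power mult.assoc cong_def)
  qed
  have shift: "(\<forall>k\<in>{1..p}. P k) \<longleftrightarrow> (\<forall>k<p. P (Suc k))" for P
    by (auto simp: Suc_le_eq gr0_conv_Suc)
  \<comment> \<open>The normalising factor is real and nonzero, so it does not affect
    realness.\<close>
  have scale: "of_real (1 / real p) * z \<in> \<real> \<longleftrightarrow> z \<in> \<real>" for z :: complex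
    using assms(1) by (simp add: complex_is_Real_iff)
  have "real_tensor p A \<longleftrightarrow>
      (\<forall>a b. \<forall>k<p. (\<Sum>i<p. v ^ (i * k) * Ahat a b (Suc i)) \<in> \<real>)"
    unfolding real_tensor_def shift
    by (simp add: inverse_dft_entry[OF assms(2)] scale v_def del: of_real_divide cong: imp_cong)
  also have "\<dots> \<longleftrightarrow> (\<forall>a b. \<forall>i<p. Ahat a b (Suc ((p - i) mod p)) = cnj (Ahat a b (Suc i)))"
    using dft_real_iff[OF root norm prim] by simp
  also have "\<dots> \<longleftrightarrow>
      (\<forall>i<p. frontal_slice Ahat (Suc ((p - i) mod p)) = cnj_matrix (frontal_slice Ahat (Suc i)))"
    by (auto simp: frontal_slice_def cnj_matrix_def map_matrix_def vec_eq_iff)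
  also have "\<dots> \<longleftrightarrow> (\<forall>i\<in>{1..p}. frontal_slice Ahat (Suc ((p - (i - 1)) mod p)) =
      cnj_matrix (frontal_slice Ahat i))"
    unfolding shift by simp
  \<comment> \<open>Slice 1 has index 0 and is its own reflection; it is split off because
    \<open>p - i + 2\<close> would be \<open>p + 1\<close> there.\<close>
  also have "{1..p} = insert 1 {2..p}"
    using assms(1) by auto
  also have "(\<forall>i\<in>insert 1 {2..p}. frontal_slice Ahat (Suc ((p - (i - 1)) mod p)) =
      cnj_matrix (frontal_slice Ahat i)) \<longleftrightarrow>
    frontal_slice Ahat 1 = cnj_matrix (frontal_slice Ahat 1) \<and>
    (\<forall>i\<in>{2..p}. frontal_slice Ahat (p - i + 2) = cnj_matrix (frontal_slice Ahat i))"
  proof -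
    \<comment> \<open>From \<open>i = 2\<close> on, \<open>p - (i - 1)\<close> is below
      \<open>p\<close>, so the \<open>mod\<close> does nothing.\<close>
    have "Suc ((p - (i - 1)) mod p) = p - i + 2" if "i \<in> {2..p}" for i
      using that by auto
    then show ?thesis
      by simp
  qed
  finally show ?thesis .
qed

end
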